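(* Let $H$ be a simple graph with vertex set $\{1,2,\ldots,l\}$ and let $H_1,\ldots,H_l$ be vertex-disjoint simple graphs, each of order $n$, which are commuting (i.e. $A(H_j)A(H_k)=A(H_k)A(H_j)$ for all $j,k$). Let $u_1,\ldots,u_n$ be an orthonormal basis of $\mathbb{R}^n$ consisting of common eigenvectors of $A(H_1),\ldots,A(H_l)$, and let $\lambda_{i,j}$ be defined by $A(H_j)u_i=\lambda_{i,j}u_i$ ($i=1,\ldots,n$, $j=1,\ldots,l$). For $1\le j,k\le l$ let $\rho_{j,k}=\rho_{k,j}=1$ if $jk\in E(H)$ and $0$ otherwise. Then the adjacency spectrum of the $H$-product $\Lambda_H(H_1,\ldots,H_l)$ is the union (as multisets), over $i=1,\ldots,n$, of the spectra of the $l\times l$ matrices \[ C_i=\begin{pmatrix} \lambda_{i,1} & \rho_{1,2} & \cdots & \rho_{1,l}\\ \rho_{2,1} & \lambda_{i,2} & \cdots & \rho_{2,l}\\ \vdots & \vdots & \ddots & \vdots\\ \rho_{l,1} & \rho_{l,2} & \cdots & \lambda_{i,l} \end{pmatrix}. \]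
   Context: For a graph $G$, $A(G)$ is its adjacency matrix. Given a graph $H$ on $\{1,\ldots,l\}$ and graphs $H_1,\ldots,H_l$ of the same order $n$ with $V(H_j)=\{v_{j1},\ldots,v_{jn}\}$, the $H$-product $\Lambda_H(H_1,\ldots,H_l)$ is the graph with vertex set $\bigcup_{j}V(H_j)$ and edge set $\bigcup_j E(H_j)\cup\bigcup_{jk\in E(H)}\{v_{ji}v_{ki}: i=1,\ldots,n\}$. With vertices ordered block by block, its adjacency matrix has diagonal blocks $A(H_j)$ and off-diagonal blocks $\rho_{j,k}I_n$. *)

theory Defs
  imports
    "Jordan_Normal_Form.Char_Poly"
    "Jordan_Normal_Form.VS_Connect"
    "Graph_Theory.Pair_Digraph"
begin

text \<open>
  A simple graph is a \<^locale>\<open>pair_graph\<close>: a finite, loop-free digraph with a symmetric arc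
  relation, so that the edge \<open>xy\<close> is the pair of arcs \<open>(x, y)\<close>, \<open>(y, x)\<close>.
  All index ranges \<open>1, \<dots>, m\<close> are shifted to \<open>0, \<dots>, m - 1\<close>, which is how matrices are indexed.
\<close>

text \<open>
  The adjacency matrix depends on the chosen ordering \<open>f 0, f 1, \<dots>\<close> of the vertices; it is
  meaningful if \<open>f\<close> is a bijection from \<open>{..<card (pverts G)}\<close> to \<open>pverts G\<close>.
\<close>

definition adjacency_mat :: "'a pair_pre_digraph \<Rightarrow> (nat \<Rightarrow> 'a) \<Rightarrow> real mat" where
  "adjacency_mat G f = mat (card (pverts G)) (card (pverts G))
     (\<lambda>(a, b). if (f a, f b) \<in> parcs G then 1 else 0)"

text \<open>
  The eigenvalues of a real matrix, repeated according to their multiplicity as roots of the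
  characteristic polynomial. The roots are taken in \<open>\<complex>\<close>, so that no eigenvalue is lost.
\<close>

definition mat_spectrum :: "real mat \<Rightarrow> complex multiset" where
  "mat_spectrum A = proots (char_poly (map_mat complex_of_real A))"

text \<open>
  \<open>v j 0, \<dots>, v j (n - 1)\<close> is the labelling of the vertices of \<open>Hs j\<close>, which determines the
  matching placed between \<open>Hs j\<close> and \<open>Hs k\<close> for every edge \<open>jk\<close> of \<open>H\<close>.
\<close>

definition H_product ::
  "nat pair_pre_digraph \<Rightarrow> nat \<Rightarrow> (nat \<Rightarrow> nat \<Rightarrow> 'a) \<Rightarrow> (nat \<Rightarrow> 'a pair_pre_digraph)
     \<Rightarrow> 'a pair_pre_digraph" where
  "H_product H n v Hs = \<lparr>
     pverts = (\<Union>j\<in>pverts H. pverts (Hs j)),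
     parcs = (\<Union>j\<in>pverts H. parcs (Hs j)) \<union>
             (\<Union>(j, k)\<in>parcs H. {(v j i, v k i) | i. i < n}) \<rparr>"

definition orthonormal_basis :: "nat \<Rightarrow> (nat \<Rightarrow> real vec) \<Rightarrow> bool" where
  "orthonormal_basis n u \<longleftrightarrow>
     vectorspace.basis class_ring (module_vec TYPE(real) n) (u ` {..<n}) \<and>
     (\<forall>i<n. \<forall>k<n. u i \<bullet> u k = (if i = k then 1 else 0))"

definition rho :: "nat pair_pre_digraph \<Rightarrow> nat \<Rightarrow> nat \<Rightarrow> real" where
  "rho H j k = (if (j, k) \<in> parcs H then 1 else 0)"

definition C_mat ::
  "nat pair_pre_digraph \<Rightarrow> nat \<Rightarrow> (nat \<Rightarrow> nat \<Rightarrow> real) \<Rightarrow> nat \<Rightarrow> real mat" where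
  "C_mat H l lam i = mat l l (\<lambda>(j, k). if j = k then lam i j else rho H j k)"

end

theory Submission
  imports Defs
begin

text \<open>
  Write \<open>e\<^sub>j\<close> for the standard basis of \<open>\<real>\<^sup>l\<close>. The product graph acts on
  \<open>\<real>\<^sup>l \<otimes> \<real>\<^sup>n\<close>, and because each off-diagonal block is a multiple of the identity, it maps
  \<open>e\<^sub>k \<otimes> u\<^sub>i\<close> to the sum of \<open>(C\<^sub>i)\<^sub>j\<^sub>k (e\<^sub>j \<otimes> u\<^sub>i)\<close> over \<open>j\<close>. In the orthonormal
  basis \<open>e\<^sub>j \<otimes> u\<^sub>i\<close>, its adjacency matrix is therefore block diagonal with blocks \<open>C\<^sub>i\<close>,
  and the characteristic polynomial is the product of theirs.
\<close>

section \<open>Characteristic polynomials of block diagonal matrices\<close>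

lemma char_poly_four_block_diag:
  fixes A D :: "'a :: idom mat"
  assumes "A \<in> carrier_mat n n" "D \<in> carrier_mat m m"
  shows "char_poly (four_block_mat A (0\<^sub>m n m) (0\<^sub>m m n) D) = char_poly A * char_poly D"
proof -
  have "char_poly_matrix (four_block_mat A (0\<^sub>m n m) (0\<^sub>m m n) D)
      = four_block_mat (char_poly_matrix A) (0\<^sub>m n m) (0\<^sub>m m n) (char_poly_matrix D)"
    using assms by (intro eq_matI) (auto simp: char_poly_matrix_def)
  then show ?thesis
    using assms by (simp add: char_poly_def det_four_block_mat_lower_left_zero[where n = n and m = m])
qed

text \<open>Induction on the number of blocks, splitting off the last one as the lower right corner
  of a two-by-two block matrix.\<close>

lemma char_poly_block_diag:
  fixes C :: "nat \<Rightarrow> nat \<Rightarrow> nat \<Rightarrow> 'a :: idom"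
  shows "char_poly (mat (n * l) (n * l)
      (\<lambda>(p, q). if p div l = q div l then C (p div l) (p mod l) (q mod l) else 0))
    = (\<Prod>i<n. char_poly (mat l l (\<lambda>(j, k). C i j k)))"
    (is "char_poly (?B n) = _")
proof (induction n)
  case 0
  then show ?case by (simp add: char_poly_defs)
next
  case (Suc n)
  have "?B (Suc n) = four_block_mat (?B n) (0\<^sub>m (n * l) l) (0\<^sub>m l (n * l))
      (mat l l (\<lambda>(j, k). C n j k))" (is "_ = ?F")
  proof (rule eq_matI)
    \<comment> \<open>Indices from \<open>n * l\<close> on lie in the last block, and
      \<open>p - n * l\<close> is the local index that \<open>four_block_mat\<close> uses
      there.\<close>
    have last: "p div l = n \<and> p mod l = p - n * l" if "p < l + n * l" "\<not> p < n * l" for p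
    proof -
      have div: "p div l = n" using that by (intro div_nat_eqI) (auto simp: mult.commute)
      then show ?thesis by (simp flip: minus_div_mult_eq_mod)
    qed
    have init: "p div l < n" if "p < n * l" for p
      using that by (simp add: less_mult_imp_div_less)
    fix p q assume "p < dim_row ?F" "q < dim_col ?F"
    then have pq: "p < l + n * l" "q < l + n * l" by auto
    show "?B (Suc n) $$ (p, q) = ?F $$ (p, q)"
    proof (cases "p < n * l"; cases "q < n * l")
    qed (use pq last[of p] last[of q] init[of p] init[of q] in auto)
  qed auto
  then show ?case
    using Suc by (simp add: char_poly_four_block_diag[where n = "n * l" and m = l])
qed

section \<open>Simultaneous block diagonalisation\<close>

lemma bij_betw_mod_div:
  "bij_betw (\<lambda>q. (q mod l, q div l)) {..<n * l} ({..<l} \<times> {..<n :: nat})"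
proof (rule bij_betwI[where g = "\<lambda>(j, i). i * l + j"])
  show "(\<lambda>q. (q mod l, q div l)) \<in> {..<n * l} \<rightarrow> {..<l} \<times> {..<n}"
    by (cases "l = 0") (auto simp: less_mult_imp_div_less)
  show "(\<lambda>(j, i). i * l + j) \<in> {..<l} \<times> {..<n} \<rightarrow> {..<n * l}"
  proof clarsimp
    fix i j assume "j < l" "i < n"
    then have "i * l + j < Suc i * l" "Suc i * l \<le> n * l" by (simp, intro mult_le_mono1, simp)
    then show "i * l + j < n * l" by linarith
  qed
qed auto

text \<open>Entries of matrix products are sums over one index; this turns them into sums over block
  and position. It serves two numberings: an arbitrary one of the vertices and the
  \<open>mod\<close>/\<open>div\<close> one of the new basis.\<close>

lemma sum_reindex_times:
  assumes "bij_betw \<phi> {..<N :: nat} ({..<l :: nat} \<times> {..<n :: nat})"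
  shows "(\<Sum>p<N. g (fst (\<phi> p)) (snd (\<phi> p))) = (\<Sum>j<l. \<Sum>a<n. g j a)"
  using sum.reindex_bij_betw[OF assms, of "\<lambda>(j, a). g j a"]
  by (simp add: sum.cartesian_product case_prod_beta)

text \<open>By \<open>act\<close>, every block \<open>(j, k)\<close> of \<open>F\<close> has all
  \<open>U i\<close> as eigenvectors, so \<open>F\<close> maps \<open>e_k \<otimes> U i\<close> into
  the span of the \<open>e_j \<otimes> U i\<close> with coefficients \<open>C i j k\<close>. By
  \<open>orth\<close>, changing to this basis is a similarity. Leaving \<open>\<phi>\<close>
  arbitrary allows any ordering of the vertices.\<close>

lemma char_poly_simultaneous_block:
  fixes F :: "nat \<times> nat \<Rightarrow> nat \<times> nat \<Rightarrow> 'a :: field"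
  assumes \<phi>: "bij_betw \<phi> {..<n * l} ({..<l} \<times> {..<n})"
    and orth: "\<And>i k. i < n \<Longrightarrow> k < n \<Longrightarrow> (\<Sum>a<n. U i a * U k a) = (if i = k then 1 else 0)"
    and act: "\<And>i j k a. i < n \<Longrightarrow> j < l \<Longrightarrow> k < l \<Longrightarrow> a < n \<Longrightarrow>
      (\<Sum>b<n. F (j, a) (k, b) * U i b) = C i j k * U i a"
  shows "char_poly (mat (n * l) (n * l) (\<lambda>(p, q). F (\<phi> p) (\<phi> q)))
    = (\<Prod>i<n. char_poly (mat l l (\<lambda>(j, k). C i j k)))"
proof -
  let ?N = "n * l"
  define A where "A = mat ?N ?N (\<lambda>(p, q). F (\<phi> p) (\<phi> q))"
  define B where "B = mat ?N ?N
    (\<lambda>(p, q). if p div l = q div l then C (p div l) (p mod l) (q mod l) else 0)"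
  \<comment> \<open>Column \<open>q\<close> is the vector
    \<open>e_(q mod l) \<otimes> U (q div l)\<close>, with its coordinates listed in the order
    \<open>\<phi>\<close>. Taking the eigenvector index as the quotient makes the columns belonging
    to one \<open>C i\<close> consecutive.\<close>
  define P where "P = mat ?N ?N
    (\<lambda>(p, q). if fst (\<phi> p) = q mod l then U (q div l) (snd (\<phi> p)) else 0)"
  have carr: "A \<in> carrier_mat ?N ?N" "B \<in> carrier_mat ?N ?N" "P \<in> carrier_mat ?N ?N"
    by (auto simp: A_def B_def P_def)
  have md: "q mod l < l" "q div l < n" if "q < ?N" for q
    using bij_betwE[OF bij_betw_mod_div[of l n]] that by auto
  have \<phi>_less: "fst (\<phi> p) < l" "snd (\<phi> p) < n" if "p < ?N" for p
    using bij_betwE[OF \<phi>] that by (auto simp: mem_Times_iff)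
  have PtP: "P\<^sup>T * P = 1\<^sub>m ?N"
  proof (rule eq_matI)
    fix q q' assume "q < dim_row (1\<^sub>m ?N :: 'a mat)" "q' < dim_col (1\<^sub>m ?N :: 'a mat)"
    then have q: "q < ?N" "q' < ?N" by auto
    let ?g = "\<lambda>j a. (if j = q mod l then U (q div l) a else 0) *
      (if j = q' mod l then U (q' div l) a else 0)"
    have "(P\<^sup>T * P) $$ (q, q') = (\<Sum>p<?N. ?g (fst (\<phi> p)) (snd (\<phi> p)))"
      using q by (simp add: P_def scalar_prod_def atLeast0LessThan)
    also have "\<dots> = (\<Sum>j<l. \<Sum>a<n. ?g j a)"
      by (rule sum_reindex_times[OF \<phi>])
    also have "\<dots> = (\<Sum>j<l. if j = q mod l then
        (if q mod l = q' mod l then \<Sum>a<n. U (q div l) a * U (q' div l) a else 0) else 0)"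
      by (rule sum.cong) auto
    \<comment> \<open>The unit vector factors force equal remainders, and \<open>orth\<close> then
      forces equal quotients.\<close>
    also have "\<dots> = (if q mod l = q' mod l \<and> q div l = q' div l then 1 else 0)"
      using md[OF q(1)] md[OF q(2)] by (simp add: orth)
    also have "\<dots> = 1\<^sub>m ?N $$ (q, q')"
      using q by (auto) (metis div_mult_mod_eq)
    finally show "(P\<^sup>T * P) $$ (q, q') = 1\<^sub>m ?N $$ (q, q')" .
  qed (use carr in auto)
  then have PPt: "P * P\<^sup>T = 1\<^sub>m ?N"
    using mat_mult_left_right_inverse carr by (metis transpose_carrier_mat)
  \<comment> \<open>Both entries at \<open>(p, q)\<close> equal \<open>C i j k * U i a\<close>: on
    the left by \<open>act\<close>, on the right because column \<open>q\<close> of \<open>B\<close>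
    is supported on block \<open>i\<close>.\<close>
  have AP: "A * P = P * B"
  proof (rule eq_matI)
    fix p q assume "p < dim_row (P * B)" "q < dim_col (P * B)"
    then have pq: "p < ?N" "q < ?N" using carr by auto
    obtain j a where ja: "\<phi> p = (j, a)" "j < l" "a < n"
      using \<phi>_less[OF pq(1)] by (cases "\<phi> p") auto
    define k i where "k = q mod l" and "i = q div l"
    have ki: "k < l" "i < n" using md[OF pq(2)] by (auto simp: k_def i_def)
    have "(A * P) $$ (p, q) = (\<Sum>r<?N. (\<lambda>k' b. F (j, a) (k', b) * (if k' = k then U i b else 0))
        (fst (\<phi> r)) (snd (\<phi> r)))"
      unfolding k_def i_def
      using pq by (simp add: A_def P_def scalar_prod_def atLeast0LessThan ja)
    also have "\<dots> = (\<Sum>k'<l. \<Sum>b<n. F (j, a) (k', b) * (if k' = k then U i b else 0))"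
      by (rule sum_reindex_times[OF \<phi>])
    also have "\<dots> = (\<Sum>k'<l. if k' = k then \<Sum>b<n. F (j, a) (k, b) * U i b else 0)"
      by (rule sum.cong) auto
    also have "\<dots> = C i j k * U i a"
      using ki ja by (simp add: act)
    \<comment> \<open>The single term is padded with zeros to a double sum over \<open>j'\<close>
      and \<open>i'\<close>, which reindexes to the sum defining an entry of
      \<open>P * B\<close>.\<close>
    also have "\<dots> = (\<Sum>j'<l. if j' = j then U i a * C i j k else 0)"
      using ki ja by simp
    also have "\<dots> = (\<Sum>j'<l. \<Sum>i'<n. (if j = j' then U i' a else 0) *
        (if i' = i then C i' j' k else 0))"
      by (rule sum.cong) (use ki in \<open>auto simp: if_distrib cong: if_cong\<close>)
    also have "\<dots> = (\<Sum>r<?N. (\<lambda>j' i'. (if j = j' then U i' a else 0) *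
        (if i' = i then C i' j' k else 0)) (r mod l) (r div l))"
      using sum_reindex_times[OF bij_betw_mod_div[of l n], symmetric] by simp
    also have "\<dots> = (P * B) $$ (p, q)"
      using pq by (simp add: B_def P_def scalar_prod_def atLeast0LessThan ja k_def i_def cong: if_cong)
    finally show "(A * P) $$ (p, q) = (P * B) $$ (p, q)" .
  qed (use carr in auto)
  have "A = A * (P * P\<^sup>T)" using carr by (simp add: PPt)
  also have "\<dots> = P * B * P\<^sup>T"
    using carr by (metis AP assoc_mult_mat transpose_carrier_mat)
  finally have "similar_mat A B"
    using carr PtP PPt by (intro similar_matI[where n = ?N and P = P and Q = "P\<^sup>T"]) auto
  then have "char_poly A = char_poly B" by (rule char_poly_similar)
  also have "\<dots> = (\<Prod>i<n. char_poly (mat l l (\<lambda>(j, k). C i j k)))"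
    unfolding B_def by (rule char_poly_block_diag)
  finally show ?thesis unfolding A_def .
qed

section \<open>From characteristic polynomials to spectra\<close>

lemma mat_spectrum_eq:
  assumes "A \<in> carrier_mat m m"
  shows "mat_spectrum A = proots (map_poly complex_of_real (char_poly A))"
  unfolding mat_spectrum_def using of_real_hom.char_poly_hom[OF assms] by metis

lemma mat_spectrum_eq_sum:
  assumes A: "A \<in> carrier_mat m m" and B: "\<And>i. i < n \<Longrightarrow> B i \<in> carrier_mat l l"
    and eq: "char_poly A = (\<Prod>i<n. char_poly (B i))"
  shows "mat_spectrum A = (\<Sum>i<n. mat_spectrum (B i))"
proof -
  interpret map_poly_comm_ring_hom complex_of_real ..
  \<comment> \<open>The roots of a product form the sum of the root multisets only if no factor
    vanishes; these factors are monic.\<close>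
  have nz: "map_poly complex_of_real (char_poly (B i)) \<noteq> 0" if "i < n" for i
    using degree_monic_char_poly[OF B[OF that]]
    by (metis coeff_0 coeff_map_poly of_real_0 of_real_1 zero_neq_one)
  have "mat_spectrum A = proots (\<Prod>i<n. map_poly complex_of_real (char_poly (B i)))"
    using A by (simp add: mat_spectrum_eq eq hom_prod)
  also have "\<dots> = (\<Sum>i<n. mat_spectrum (B i))"
    using nz by (subst proots_prod) (auto simp: mat_spectrum_eq[OF B])
  finally show ?thesis .
qed

section \<open>The adjacency matrix of the product graph\<close>

theorem theorem3p1:
  fixes H :: "nat pair_pre_digraph"
    and Hs :: "nat \<Rightarrow> 'a pair_pre_digraph"
    and l n :: nat
    and v :: "nat \<Rightarrow> nat \<Rightarrow> 'a"
    and u :: "nat \<Rightarrow> real vec"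
    and lam :: "nat \<Rightarrow> nat \<Rightarrow> real"
    and w :: "nat \<Rightarrow> 'a"
  assumes H: "pair_graph H" "pverts H = {..<l}"
    and Hs: "\<And>j. j < l \<Longrightarrow> pair_graph (Hs j)"
    and order: "\<And>j. j < l \<Longrightarrow> card (pverts (Hs j)) = n"
    and disj: "\<And>j k. j < l \<Longrightarrow> k < l \<Longrightarrow> j \<noteq> k \<Longrightarrow> pverts (Hs j) \<inter> pverts (Hs k) = {}"
    and labelling: "\<And>j. j < l \<Longrightarrow> bij_betw (v j) {..<n} (pverts (Hs j))"
    and commuting: "\<And>j k. j < l \<Longrightarrow> k < l \<Longrightarrow>
      adjacency_mat (Hs j) (v j) * adjacency_mat (Hs k) (v k)
      = adjacency_mat (Hs k) (v k) * adjacency_mat (Hs j) (v j)"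
    and basis: "orthonormal_basis n u"
    and eigen: "\<And>i j. i < n \<Longrightarrow> j < l \<Longrightarrow> eigenvector (adjacency_mat (Hs j) (v j)) (u i) (lam i j)"
    and ordering: "bij_betw w {..<card (pverts (H_product H n v Hs))} (pverts (H_product H n v Hs))"
  shows "mat_spectrum (adjacency_mat (H_product H n v Hs) w) = (\<Sum>i<n. mat_spectrum (C_mat H l lam i))"
proof -
  let ?G = "H_product H n v Hs"
  let ?x = "\<lambda>(j, a). v j a"
  \<comment> \<open>The adjacency matrix of the product, indexed by pairs (block, position) instead
    of through \<open>w\<close>.\<close>
  define F where "F s t = (if (?x s, ?x t) \<in> parcs ?G then 1 else 0 :: real)" for s t
  interpret H: pair_graph H by (fact H(1))
  have v_mem: "v j a \<in> pverts (Hs j)" if "j < l" "a < n" for j a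
    using bij_betwE[OF labelling[OF that(1)]] that by auto
  have same: "j = k" if "x \<in> pverts (Hs j)" "x \<in> pverts (Hs k)" "j < l" "k < l" for x j k
    using disj that by blast
  have v_eq: "v j a = v k b \<longleftrightarrow> j = k \<and> a = b" if "j < l" "k < l" "a < n" "b < n" for j k a b
  proof
    assume eq: "v j a = v k b"
    then have "j = k" using same v_mem that by metis
    moreover have "inj_on (v j) {..<n}" using labelling[OF that(1)] by (simp add: bij_betw_def)
    ultimately show "j = k \<and> a = b" using eq that by (auto dest: inj_onD)
  qed simp
  have pv: "pverts ?G = (\<Union>j<l. pverts (Hs j))" by (simp add: H_product_def H(2))
  have x: "bij_betw ?x ({..<l} \<times> {..<n}) (pverts ?G)"
    unfolding bij_betw_def
  proof
    show "inj_on ?x ({..<l} \<times> {..<n})" using v_eq by (auto simp: inj_on_def)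
    have "v j ` {..<n} = pverts (Hs j)" if "j < l" for j
      using labelling[OF that] by (simp add: bij_betw_def)
    then show "?x ` ({..<l} \<times> {..<n}) = pverts ?G"
      unfolding pv by (fastforce simp: image_iff)
  qed
  have card: "card (pverts ?G) = n * l"
    using bij_betw_same_card[OF x] by (simp add: mult.commute)
  \<comment> \<open>\<open>\<phi> p\<close> is the block and position of the vertex
    \<open>w p\<close>.\<close>
  define \<phi> where "\<phi> = the_inv_into ({..<l} \<times> {..<n}) ?x \<circ> w"
  have \<phi>: "bij_betw \<phi> {..<n * l} ({..<l} \<times> {..<n})"
    unfolding \<phi>_def using ordering card by (auto intro: bij_betw_trans bij_betw_the_inv_into[OF x])
  have x\<phi>: "?x (\<phi> p) = w p" if "p < n * l" for p
    unfolding \<phi>_def o_def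
    by (rule f_the_inv_into_f_bij_betw[OF x]) (use bij_betwE[OF ordering] that card in auto)
  have adj: "adjacency_mat ?G w = mat (n * l) (n * l) (\<lambda>(p, q). F (\<phi> p) (\<phi> q))"
    unfolding adjacency_mat_def card F_def by (rule cong_mat) (auto simp: x\<phi>)
  have arcs_in: "v j a \<in> pverts (Hs k) \<and> v j' b \<in> pverts (Hs k)"
    if "(v j a, v j' b) \<in> parcs (Hs k)" "k < l" for j a j' b k
  proof -
    interpret pair_graph "Hs k" by (rule Hs[OF that(2)])
    show ?thesis using that(1) by (auto dest: in_arcsD1 in_arcsD2)
  qed
  have F_diag: "F (j, a) (j, b) = adjacency_mat (Hs j) (v j) $$ (a, b)"
    if "j < l" "a < n" "b < n" for j a b
  proof -
    have "(v j a, v j b) \<in> parcs ?G \<longleftrightarrow> (v j a, v j b) \<in> parcs (Hs j)"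
    proof
      assume "(v j a, v j b) \<in> parcs ?G"
      then consider (block) k where "k < l" "(v j a, v j b) \<in> parcs (Hs k)"
        | (link) k k' i where "(k, k') \<in> parcs H" "i < n" "v j a = v k i" "v j b = v k' i"
        by (auto simp: H_product_def H(2))
      then show "(v j a, v j b) \<in> parcs (Hs j)"
      proof cases
        case block
        then show ?thesis using arcs_in same v_mem that by metis
      next
        \<comment> \<open>A matching arc inside block \<open>j\<close> would come from a loop of
          \<open>H\<close> at \<open>j\<close>.\<close>
        case link
        moreover have "k < l" "k' < l" using H.in_arcsD1 H.in_arcsD2 link(1) H(2) by auto
        ultimately have "k = k'" using v_eq that by metis
        then show ?thesis using H.pair_no_loops[OF link(1)] by simp
      qed
    qed (use that in \<open>auto simp: H_product_def H(2)\<close>)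
    then show ?thesis using that order by (simp add: F_def adjacency_mat_def)
  qed
  have F_off: "F (j, a) (k, b) = (if a = b then rho H j k else 0)"
    if "j < l" "k < l" "a < n" "b < n" "j \<noteq> k" for j k a b
  proof -
    have "(v j a, v k b) \<in> parcs ?G \<longleftrightarrow> a = b \<and> (j, k) \<in> parcs H"
    proof
      assume "(v j a, v k b) \<in> parcs ?G"
      then consider (block) m where "m < l" "(v j a, v k b) \<in> parcs (Hs m)"
        | (link) m m' i where "(m, m') \<in> parcs H" "i < n" "v j a = v m i" "v k b = v m' i"
        by (auto simp: H_product_def H(2))
      then show "a = b \<and> (j, k) \<in> parcs H"
      proof cases
        \<comment> \<open>An arc of a single factor has both ends in that factor, so disjointness
          would give \<open>j = k\<close>.\<close>
        case block
        then show ?thesis using arcs_in same v_mem that by metis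
      next
        case link
        moreover have "m < l" "m' < l" using H.in_arcsD1 H.in_arcsD2 link(1) H(2) by auto
        ultimately show ?thesis using v_eq that by metis
      qed
    next
      assume "a = b \<and> (j, k) \<in> parcs H"
      then show "(v j a, v k b) \<in> parcs ?G"
        using that unfolding H_product_def by auto
    qed
    then show ?thesis by (auto simp: F_def rho_def)
  qed
  \<comment> \<open>The length is read off from the eigenvector equation for \<open>Hs 0\<close>, so
    \<open>l = 0\<close> is treated separately below: there both sides are 1.\<close>
  have u_dim: "dim_vec (u i) = n" if "i < n" "0 < l" for i
    using eigen[OF that] order[OF that(2)] by (auto simp: eigenvector_def adjacency_mat_def)
  have "char_poly (adjacency_mat ?G w) = (\<Prod>i<n. char_poly (C_mat H l lam i))"
  proof (cases "l = 0")
    case True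
    then show ?thesis by (simp add: adj C_mat_def char_poly_defs)
  next
    case False
    show ?thesis
      unfolding adj C_mat_def
    proof (rule char_poly_simultaneous_block[OF \<phi>, where U = "\<lambda>i a. u i $ a"])
      fix i k assume "i < n" "k < n"
      moreover from this have "u i \<bullet> u k = (if i = k then 1 else 0)"
        using basis by (simp add: orthonormal_basis_def)
      ultimately show "(\<Sum>a<n. u i $ a * u k $ a) = (if i = k then 1 else 0)"
        using False by (simp add: scalar_prod_def u_dim atLeast0LessThan)
    next
      fix i j k a assume ik: "i < n" "j < l" "k < l" "a < n"
      show "(\<Sum>b<n. F (j, a) (k, b) * u i $ b) = (if j = k then lam i j else rho H j k) * u i $ a"
      proof (cases "j = k")
        case True
        have "(\<Sum>b<n. F (j, a) (j, b) * u i $ b) = (adjacency_mat (Hs j) (v j) *\<^sub>v u i) $ a"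
          using ik order False
          by (simp add: F_diag scalar_prod_def u_dim atLeast0LessThan adjacency_mat_def)
        also have "\<dots> = (lam i j \<cdot>\<^sub>v u i) $ a"
          using eigen[OF ik(1,2)] by (simp add: eigenvector_def)
        finally show ?thesis using True ik False by (simp add: u_dim)
      next
        case off: False
        \<comment> \<open>This block is \<open>rho H j k\<close> times the identity, so every vector
          is an eigenvector of it.\<close>
        have "(\<Sum>b<n. F (j, a) (k, b) * u i $ b) = (\<Sum>b<n. if b = a then rho H j k * u i $ a else 0)"
          by (rule sum.cong) (use ik off F_off in auto)
        then show ?thesis using off ik by simp
      qed
    qed
  qed
  then show ?thesis
    by (intro mat_spectrum_eq_sum[where l = l and m = "n * l"]) (auto simp: adj C_mat_def)
qed

end
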